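(* Suppose that, given $\boldsymbol{\theta}$ and $\gamma$, the responses $y_1,\dots,y_n$ are independent with $y_i\sim\mathrm{N}(\mu(\boldsymbol{\theta},\mathbf{d}_i),\gamma)$, where the scale parameter (variance) $\gamma$ is an unknown nuisance parameter with prior distribution $\gamma\sim\mathrm{IG}(s_1/2,s_2/2)$, and that the likelihood used is the marginal likelihood obtained by integrating out $\gamma$. Define, for $\mathbf{d}\in\mathcal{D}$, $$\phi(\mathbf{d})=\sum_{j=1}^p\mathrm{E}_{\boldsymbol{\theta}}\left[\left(\frac{\partial\mu(\boldsymbol{\theta},\mathbf{d})}{\partial\theta_j}\right)^2\right],$$ where the expectation is with respect to the prior distribution of $\boldsymbol{\theta}$. Then the design points of the FIG-optimal designs are given by the maximisers of $\phi$ over $\mathcal{D}$; that is, a design $\tilde{\mathbf{D}}=(\tilde{\mathbf{d}}_1^{T},\dots,\tilde{\mathbf{d}}_n^{T})^{T}\in\mathcal{D}^n$ maximises the expected Fisher information gain $U_{FIG}$ over $\mathcal{D}^n$ if and only if, for each $i=1,\dots,n$, $\tilde{\mathbf{d}}_i$ is a global maximiser of $\phi$ over $\mathcal{D}$.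
   Context: There are $k$ controllable variables $\mathbf{d}=(d_1,\dots,d_k)^{T}\in\mathcal{D}\subseteq\mathbb{R}^k$. An experiment has a fixed number $n$ of runs; run $i$ uses $\mathbf{d}_i\in\mathcal{D}$ (a design point) and yields a response $y_i$. The design is $\mathbf{D}=(\mathbf{d}_1^{T},\dots,\mathbf{d}_n^{T})^{T}\in\mathcal{D}^n$ and $\mathbf{y}=(y_1,\dots,y_n)^{T}$. The unknown parameter vector of interest is $\boldsymbol{\theta}=(\theta_1,\dots,\theta_p)^{T}\in\Theta$, with $\Theta$ a $p$-dimensional parameter space, $p\le n$; it has a prior distribution not depending on $\mathbf{D}$, and the prior of $\gamma$ is independent of $\boldsymbol{\theta}$. The mean function $\mu(\boldsymbol{\theta},\mathbf{d})$ is differentiable in $\boldsymbol{\theta}$. $\mathrm{IG}(s_1/2,s_2/2)$, with known constants $s_1>0$ (shape) and $s_2>0$ (scale), is the inverse-gamma distribution with pdf $\pi(\gamma)=\frac{s_2^{s_1/2}}{2^{s_1/2}\Gamma(s_1/2)}\gamma^{-s_1/2-1}\exp\left(-\frac{s_2}{2\gamma}\right)$, $\gamma>0$. The marginal likelihood is $\pi(\mathbf{y}\vert\boldsymbol{\theta},\mathbf{D})=\int_0^\infty\pi(\mathbf{y}\vert\boldsymbol{\theta},\gamma,\mathbf{D})\pi(\gamma)\,\mathrm{d}\gamma$, where $\pi(\mathbf{y}\vert\boldsymbol{\theta},\gamma,\mathbf{D})$ is the product of the normal densities of the $y_i$. The Fisher information matrix is the $p\times p$ matrix computed from this marginal likelihood: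 $\mathcal{I}(\boldsymbol{\theta},\mathbf{D})=\mathrm{E}_{\mathbf{y}\vert\boldsymbol{\theta},\mathbf{D}}\left[\frac{\partial\log\pi(\mathbf{y}\vert\boldsymbol{\theta},\mathbf{D})}{\partial\boldsymbol{\theta}}\frac{\partial\log\pi(\mathbf{y}\vert\boldsymbol{\theta},\mathbf{D})}{\partial\boldsymbol{\theta}^{T}}\right]$. The expected Fisher information gain (FIG) is $U_{FIG}(\mathbf{D})=\mathrm{E}_{\boldsymbol{\theta}}[\mathrm{tr}\,\mathcal{I}(\boldsymbol{\theta},\mathbf{D})]$, the expectation being over the prior; standard regularity conditions are assumed, and the Fisher information and this expectation are assumed to exist (be finite) for all designs. A design is FIG-optimal if it maximises $U_{FIG}$ over $\mathcal{D}^n$. *)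

theory Defs
  imports "HOL-Probability.Probability"
begin

text \<open>
  The type \<open>'k\<close> indexes the controllable variables, \<open>'p\<close> the parameters and \<open>'n\<close> the runs.
  A design is an n-by-k matrix \<open>D\<close> whose row \<open>D $ i\<close> is the design point of run \<open>i\<close>.
\<close>

definition partial_deriv :: "(real ^ 'p \<Rightarrow> real) \<Rightarrow> real ^ 'p \<Rightarrow> 'p::finite \<Rightarrow> real" where
  "partial_deriv f \<theta> j = deriv (\<lambda>h. f (\<theta> + h *\<^sub>R axis j 1)) 0"

text \<open>The density of \<open>IG(s1/2, s2/2)\<close>, with shape \<open>s1/2\<close> and scale \<open>s2/2\<close>.\<close>

definition ig_density :: "real \<Rightarrow> real \<Rightarrow> real \<Rightarrow> real" where
  "ig_density s1 s2 \<gamma> =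
     (if \<gamma> > 0
      then s2 powr (s1 / 2) / (2 powr (s1 / 2) * Gamma (s1 / 2))
           * \<gamma> powr (- s1 / 2 - 1) * exp (- s2 / (2 * \<gamma>))
      else 0)"

text \<open>The parameter \<open>\<gamma>\<close> is a variance, whereas \<^const>\<open>normal_density\<close> expects a standard deviation.\<close>

definition likelihood ::
  "(real ^ 'p \<Rightarrow> real ^ 'k \<Rightarrow> real) \<Rightarrow> real ^ 'p \<Rightarrow> real \<Rightarrow> real ^ 'k ^ 'n \<Rightarrow> real ^ 'n \<Rightarrow> real" where
  "likelihood \<mu> \<theta> \<gamma> D y = (\<Prod>i\<in>UNIV. normal_density (\<mu> \<theta> (D $ i)) (sqrt \<gamma>) (y $ i))"

definition marginal_likelihood ::
  "(real ^ 'p \<Rightarrow> real ^ 'k \<Rightarrow> real) \<Rightarrow> real \<Rightarrow> real \<Rightarrow> real ^ 'p \<Rightarrow> real ^ 'k ^ 'n \<Rightarrow> real ^ 'n \<Rightarrow> real"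
where
  "marginal_likelihood \<mu> s1 s2 \<theta> D y =
     (LINT \<gamma>:{0<..}|lborel. likelihood \<mu> \<theta> \<gamma> D y * ig_density s1 s2 \<gamma>)"

text \<open>The conditional distribution of the responses given the parameters, \<open>\<gamma>\<close> integrated out.\<close>

definition response_distr ::
  "(real ^ 'p \<Rightarrow> real ^ 'k \<Rightarrow> real) \<Rightarrow> real \<Rightarrow> real \<Rightarrow> real ^ 'p \<Rightarrow> real ^ 'k ^ 'n \<Rightarrow> (real ^ 'n) measure"
where
  "response_distr \<mu> s1 s2 \<theta> D = density lborel (\<lambda>y. ennreal (marginal_likelihood \<mu> s1 s2 \<theta> D y))"

definition score ::
  "(real ^ 'p \<Rightarrow> real ^ 'k \<Rightarrow> real) \<Rightarrow> real \<Rightarrow> real \<Rightarrow> real ^ 'p \<Rightarrow> real ^ 'k ^ 'n \<Rightarrow> real ^ 'n \<Rightarrow> real ^ 'p"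
where
  "score \<mu> s1 s2 \<theta> D y =
     (\<chi> j. partial_deriv (\<lambda>t. ln (marginal_likelihood \<mu> s1 s2 t D y)) \<theta> j)"

definition fisher_information ::
  "(real ^ 'p \<Rightarrow> real ^ 'k \<Rightarrow> real) \<Rightarrow> real \<Rightarrow> real \<Rightarrow> real ^ 'p \<Rightarrow> real ^ 'k ^ 'n \<Rightarrow> real ^ 'p ^ 'p"
where
  "fisher_information \<mu> s1 s2 \<theta> D =
     (\<chi> i j. \<integral>y. score \<mu> s1 s2 \<theta> D y $ i * score \<mu> s1 s2 \<theta> D y $ j
               \<partial>response_distr \<mu> s1 s2 \<theta> D)"

definition U_FIG ::
  "(real ^ 'p) measure \<Rightarrow> (real ^ 'p \<Rightarrow> real ^ 'k \<Rightarrow> real) \<Rightarrow> real \<Rightarrow> real \<Rightarrow> real ^ 'k ^ 'n \<Rightarrow> real"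
where
  "U_FIG prior \<mu> s1 s2 D = (\<integral>\<theta>. trace (fisher_information \<mu> s1 s2 \<theta> D) \<partial>prior)"

definition phi :: "(real ^ 'p) measure \<Rightarrow> (real ^ 'p \<Rightarrow> real ^ 'k \<Rightarrow> real) \<Rightarrow> real ^ 'k \<Rightarrow> real" where
  "phi prior \<mu> d = (\<Sum>j\<in>UNIV. \<integral>\<theta>. (partial_deriv (\<lambda>t. \<mu> t d) \<theta> j)\<^sup>2 \<partial>prior)"

definition designs :: "(real ^ 'k) set \<Rightarrow> (real ^ 'k ^ 'n) set" where
  "designs \<D> = {D. \<forall>i. D $ i \<in> \<D>}"

definition FIG_optimal ::
  "(real ^ 'k) set \<Rightarrow> (real ^ 'p) measure \<Rightarrow> (real ^ 'p \<Rightarrow> real ^ 'k \<Rightarrow> real) \<Rightarrow> real \<Rightarrow> real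
   \<Rightarrow> real ^ 'k ^ 'n \<Rightarrow> bool"
where
  "FIG_optimal \<D> prior \<mu> s1 s2 D \<longleftrightarrow> is_arg_max (U_FIG prior \<mu> s1 s2) (\<lambda>D'. D' \<in> designs \<D>) D"

end

theory Submission
  imports Defs
begin

text \<open>
  Integrating the inverse-gamma variance out of the normal likelihood gives, with \<open>M\<close> the vector of mean
  responses \<open>\<mu>(\<theta>, d\<^sub>i)\<close>, a multivariate t density
  \<open>C * (s2 + (norm (y - M))\<^sup>2) powr (- (s1 + n) / 2)\<close> of the response \<open>y\<close>
  (\<open>marginal_likelihood_eq\<close>). It depends on the parameters and on the design only through its centre \<open>M\<close>,
  and it is radial about that centre. Its score is
  \<open>(s1 + n) / (s2 + (norm z)\<^sup>2) * (a\<^sub>j \<bullet> z)\<close> with residual \<open>z = y - M\<close> and \<open>a\<^sub>j\<close> the vector of the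
  derivatives \<open>\<partial>\<mu>(\<theta>, d\<^sub>i)/\<partial>\<theta>\<^sub>j\<close> over the runs \<open>i\<close> (\<open>score_eq\<close>).

  A radial density cannot distinguish directions, so the expected squared score is a fixed multiple of
  \<open>(norm a\<^sub>j)\<^sup>2\<close> (\<open>radial_second_moment\<close>). Hence the trace of the Fisher information is
  \<open>c * (\<Sum>i. \<Sum>j. (\<partial>\<mu>(\<theta>, d\<^sub>i)/\<partial>\<theta>\<^sub>j)\<^sup>2)\<close> with one constant \<open>c\<close> for all \<open>\<theta>\<close> and all designs
  (\<open>trace_fisher_information\<close>). That \<open>c\<close> is finite and strictly positive is essential, since otherwise the
  criterion would be degenerate; this is \<open>t_second_moment\<close>, which rests on \<open>integrable_t_kernel\<close>.

  Averaging over the prior gives \<open>U_FIG(D) = c * (\<Sum>i. \<phi>(d\<^sub>i))\<close>, and a separable sum is maximised exactly by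
  maximising every summand (\<open>is_arg_max_separable_sum\<close>). To exchange the sum with the prior expectation, each squared
  partial derivative must be integrable on its own. Domination comes from the information of the constant
  design; the delicate point is measurability, because \<open>\<Theta>\<close> may be any set and \<open>\<mu>\<close> is uncontrolled off \<open>\<Theta>\<close>
  (\<open>partial_deriv_measurable\<close>).
\<close>

section \<open>The inverse-gamma kernel\<close>

text \<open>
  This makes the kernel integrable near \<open>0\<close>: since \<open>x / p \<le> exp (x / p)\<close>, the factor
  \<open>exp (- x)\<close> with \<open>x = T / (2 * \<gamma>)\<close> is at most \<open>(p / x) powr p\<close>, and \<open>p = m + 1\<close> is the exponent
  for which the powers of \<open>\<gamma>\<close> cancel.
\<close>

lemma ig_kernel_le:
  fixes m T \<gamma> :: real
  assumes "m > 0" "T > 0" "\<gamma> > 0"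
  shows "\<gamma> powr (-m - 1) * exp (- T / (2 * \<gamma>)) \<le> (2 * (m + 1) / T) powr (m + 1)"
proof -
  define p x where "p = m + 1" and "x = T / (2 * \<gamma>)"
  have p: "p > 0" and x: "x > 0" using assms by (auto simp: p_def x_def)
  have "x / p \<le> exp (x / p)"
    using exp_ge_add_one_self[of "x / p"] by linarith
  then have "(x / p) powr p \<le> exp (x / p) powr p"
    using p x by (intro powr_mono2) auto
  also have "\<dots> = exp x"
    using p by (simp add: powr_def)
  finally have "exp (- x) \<le> 1 / (x / p) powr p"
    using p x by (simp add: exp_minus field_simps)
  also have "\<dots> = (p / x) powr p"
    using p x by (simp add: powr_divide)
  finally have "\<gamma> powr (- p) * exp (- x) \<le> \<gamma> powr (- p) * (p / x) powr p"
    by (intro mult_left_mono) auto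
  also have "p / x = \<gamma> * (2 * p / T)"
    by (simp add: x_def)
  also have "\<gamma> powr (- p) * (\<gamma> * (2 * p / T)) powr p = (2 * p / T) powr p"
    using assms p by (subst powr_mult) (auto simp: powr_minus)
  finally show ?thesis by (simp add: p_def x_def)
qed

text \<open>
  On \<open>(0, 1]\<close> the kernel is bounded; on \<open>[1, \<infinity>)\<close> it is dominated by \<open>\<gamma> powr (-m - 1)\<close>.
\<close>

lemma set_integrable_ig_kernel:
  fixes m T :: real
  assumes m: "m > 0" and T: "T > 0"
  shows "set_integrable lborel {0<..} (\<lambda>\<gamma>. \<gamma> powr (-m - 1) * exp (- T / (2 * \<gamma>)))"
proof -
  let ?k = "\<lambda>\<gamma>. \<gamma> powr (-m - 1) * exp (- T / (2 * \<gamma>))"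
  have "set_integrable lborel {0<..1} ?k"
  proof (rule set_integrable_bound)
    show "set_integrable lborel {0<..1::real} (\<lambda>_. (2 * (m + 1) / T) powr (m + 1))"
      by (simp add: set_integrable_def)
    show "set_borel_measurable lborel {0<..1} ?k"
      by (simp add: set_borel_measurable_def)
    show "AE x in lborel. x \<in> {0<..1} \<longrightarrow> norm (?k x) \<le> norm ((2 * (m + 1) / T) powr (m + 1))"
      using ig_kernel_le[OF m T] by (intro AE_I2) auto
  qed
  moreover have "set_integrable lborel {1..} ?k"
  proof (rule set_integrable_bound)
    have "(\<lambda>x. x powr (- m - 1)) absolutely_integrable_on {1::real..}"
      using has_integral_powr_to_inf[of "- m - 1" 1] m
      by (intro nonnegative_absolutely_integrable_1) (auto simp: has_integral_iff)
    then show "set_integrable lborel {1..} (\<lambda>x::real. x powr (- m - 1))"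
      unfolding set_integrable_def by (subst (asm) integrable_completion) auto
    show "set_borel_measurable lborel {1..} ?k"
      by (simp add: set_borel_measurable_def)
    show "AE x in lborel. x \<in> {1..} \<longrightarrow> norm (?k x) \<le> norm (x powr (- m - 1))"
      using T by (intro AE_I2) (auto simp: abs_mult intro!: mult_left_le)
  qed
  ultimately have "set_integrable lborel ({0<..1} \<union> {1..}) ?k"
    by (intro set_integrable_Un) auto
  also have "{0<..1} \<union> {1..} = {0::real<..}" by auto
  finally show ?thesis .
qed

text \<open>
  This number is \<open>2 powr m * Gamma m\<close>, the total mass of the unnormalised \<open>IG(m, 1/2)\<close> density. Only its
  sign matters for the comparison of designs, so it is kept as an integral.
\<close>

definition ig_const :: "real \<Rightarrow> real" where
  "ig_const m = (LINT \<gamma>:{0<..}|lborel. \<gamma> powr (-m - 1) * exp (- 1 / (2 * \<gamma>)))"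

text \<open>
  Substitute \<open>\<gamma> = T * \<gamma>'\<close>. This is where the power law of the marginal likelihood comes from.
\<close>

lemma ig_kernel_integral:
  fixes m T :: real
  assumes "T > 0"
  shows "(LINT \<gamma>:{0<..}|lborel. \<gamma> powr (-m - 1) * exp (- T / (2 * \<gamma>))) = T powr (-m) * ig_const m"
proof -
  let ?f = "\<lambda>\<gamma>. indicator {0<..} \<gamma> *\<^sub>R (\<gamma> powr (-m - 1) * exp (- T / (2 * \<gamma>)))"
  let ?g = "\<lambda>\<gamma>. indicator {0<..} \<gamma> *\<^sub>R (\<gamma> powr (-m - 1) * exp (- 1 / (2 * \<gamma>)))"
  have "(\<integral>\<gamma>. ?f \<gamma> \<partial>lborel) = \<bar>T\<bar> *\<^sub>R (\<integral>\<gamma>. ?f (0 + T * \<gamma>) \<partial>lborel)"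
    using assms by (intro lborel_integral_real_affine) auto
  also have "(\<lambda>\<gamma>. ?f (0 + T * \<gamma>)) = (\<lambda>\<gamma>. T powr (-m - 1) * ?g \<gamma>)"
    using assms by (auto simp: fun_eq_iff indicator_def zero_less_mult_iff powr_mult)
  also have "\<bar>T\<bar> *\<^sub>R (\<integral>\<gamma>. T powr (-m - 1) * ?g \<gamma> \<partial>lborel) = T * T powr (-m - 1) * (\<integral>\<gamma>. ?g \<gamma> \<partial>lborel)"
    using assms by simp
  also have "T * T powr (-m - 1) = T powr (-m)"
    using assms powr_add[of T 1 "-m - 1"] by simp
  finally show ?thesis
    by (simp add: ig_const_def set_lebesgue_integral_def)
qed

lemma ig_const_pos:
  assumes "m > 0"
  shows "ig_const m > 0"
proof -
  let ?g = "\<lambda>\<gamma>. indicator {0<..} \<gamma> *\<^sub>R (\<gamma> powr (-m - 1) * exp (- 1 / (2 * \<gamma>)))"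
  have int: "integrable lborel ?g"
    using set_integrable_ig_kernel[of m 1] assms by (simp add: set_integrable_def)
  have nonneg: "AE x in lborel. 0 \<le> ?g x" by (auto intro!: AE_I2)
  have "(\<integral>\<gamma>. ?g \<gamma> \<partial>lborel) \<noteq> 0"
  proof
    assume "(\<integral>\<gamma>. ?g \<gamma> \<partial>lborel) = 0"
    then have "AE x in lborel. ?g x = 0"
      using integral_nonneg_eq_0_iff_AE[OF int nonneg] by simp
    then have "AE x in lborel. x \<notin> {0::real<..}"
      by eventually_elim (auto simp: indicator_def split: if_splits)
    then have "emeasure lborel {0::real<..} = 0"
      by (subst (asm) AE_iff_measurable[of "{0<..}"]) auto
    moreover have "emeasure lborel {0::real<..1} \<le> emeasure lborel {0::real<..}"
      by (intro emeasure_mono) auto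
    ultimately show False by simp
  qed
  moreover have "(\<integral>\<gamma>. ?g \<gamma> \<partial>lborel) \<ge> 0"
    by (intro integral_nonneg_AE nonneg)
  ultimately have "(\<integral>\<gamma>. ?g \<gamma> \<partial>lborel) > 0" by linarith
  then show ?thesis
    by (simp add: ig_const_def set_lebesgue_integral_def)
qed

section \<open>The marginal likelihood\<close>

definition mean_response ::
  "(real ^ 'p \<Rightarrow> real ^ 'k \<Rightarrow> real) \<Rightarrow> real ^ 'p \<Rightarrow> real ^ 'k ^ 'n \<Rightarrow> real ^ 'n" where
  "mean_response \<mu> \<theta> D = (\<chi> i. \<mu> \<theta> (D $ i))"

lemma likelihood_eq:
  fixes D :: "real ^ 'k ^ 'n"
  assumes "\<gamma> > 0"
  shows "likelihood \<mu> \<theta> \<gamma> D y = 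
    (2 * pi * \<gamma>) powr (- real CARD('n) / 2) * exp (- (norm (y - mean_response \<mu> \<theta> D))\<^sup>2 / (2 * \<gamma>))"
proof -
  have "likelihood \<mu> \<theta> \<gamma> D y = 
     (1 / sqrt (2 * pi * \<gamma>)) ^ CARD('n) * exp (\<Sum>i\<in>UNIV. - (y $ i - \<mu> \<theta> (D $ i))\<^sup>2 / (2 * \<gamma>))"
    using assms by (simp add: likelihood_def normal_density_def prod_dividef exp_sum power_divide)
  also have "(\<Sum>i\<in>UNIV. - (y $ i - \<mu> \<theta> (D $ i))\<^sup>2 / (2 * \<gamma>)) = - (norm (y - mean_response \<mu> \<theta> D))\<^sup>2 / (2 * \<gamma>)"
    by (simp add: norm_vec_def L2_set_def sum_nonneg mean_response_def sum_negf sum_divide_distrib[symmetric])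
  also have "1 / sqrt (2 * pi * \<gamma>) = (2 * pi * \<gamma>) powr (- 1 / 2)"
    using assms by (simp add: powr_minus powr_half_sqrt field_simps)
  also have "\<dots> ^ CARD('n) = (2 * pi * \<gamma>) powr (- real CARD('n) / 2)"
    using assms by (simp add: powr_realpow[symmetric] powr_powr)
  finally show ?thesis .
qed

text \<open>
  As a function of \<open>\<gamma>\<close>, likelihood times prior is again an inverse-gamma kernel, with exponent
  \<open>(s1 + n) / 2\<close> and with the residual sum of squares added to \<open>s2\<close>. Integrating out \<open>\<gamma>\<close> therefore gives
  a multivariate t density centred at the mean responses. The constant \<open>C\<close> depends neither on the
  parameters nor on the design.
\<close>

lemma marginal_likelihood_eq:
  fixes s1 s2 :: real
  assumes "s1 > 0" "s2 > 0"
  obtains C where "C > 0"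
    "\<And>(\<mu> :: real ^ 'p \<Rightarrow> real ^ 'k \<Rightarrow> real) \<theta> (D :: real ^ 'k ^ 'n) y.
       marginal_likelihood \<mu> s1 s2 \<theta> D y =
       C * (s2 + (norm (y - mean_response \<mu> \<theta> D))\<^sup>2) powr (- ((s1 + real CARD('n)) / 2))"
proof -
  define m where "m = (s1 + real CARD('n)) / 2"
  define c where "c = (2 * pi) powr (- real CARD('n) / 2) * (s2 powr (s1 / 2) / (2 powr (s1 / 2) * Gamma (s1 / 2)))"
  have "m > 0" using assms by (auto simp: m_def)
  have c: "c > 0" using assms by (simp add: c_def Gamma_real_pos)
  show thesis
  proof
    show "c * ig_const m > 0" using c ig_const_pos[OF \<open>m > 0\<close>] by simp
    fix \<mu> :: "real ^ 'p \<Rightarrow> real ^ 'k \<Rightarrow> real" and \<theta> and D :: "real ^ 'k ^ 'n" and y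
    define T where "T = s2 + (norm (y - mean_response \<mu> \<theta> D))\<^sup>2"
    have "T > 0" using assms by (simp add: T_def add_pos_nonneg)
    have "likelihood \<mu> \<theta> \<gamma> D y * ig_density s1 s2 \<gamma> = c * (\<gamma> powr (-m - 1) * exp (- T / (2 * \<gamma>)))"
      if "\<gamma> > 0" for \<gamma>
    proof -
      have e: "exp (- (norm (y - mean_response \<mu> \<theta> D))\<^sup>2 / (2 * \<gamma>)) * exp (- s2 / (2 * \<gamma>)) = exp (- T / (2 * \<gamma>))"
        by (simp add: T_def mult_exp_exp add_divide_distrib[symmetric] diff_divide_distrib)
      have p: "(2 * pi * \<gamma>) powr (- real CARD('n) / 2) * \<gamma> powr (- s1 / 2 - 1)
          = (2 * pi) powr (- real CARD('n) / 2) * \<gamma> powr (-m - 1)"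
        using that by (simp add: powr_mult m_def powr_add[symmetric] add_divide_distrib algebra_simps)
      show ?thesis
        unfolding likelihood_eq[OF that] ig_density_def c_def e[symmetric]
        using that p by (simp add: field_simps)
    qed
    then have "marginal_likelihood \<mu> s1 s2 \<theta> D y =
        (LINT \<gamma>:{0<..}|lborel. c * (\<gamma> powr (-m - 1) * exp (- T / (2 * \<gamma>))))"
      unfolding marginal_likelihood_def by (intro set_lebesgue_integral_cong) auto
    also have "\<dots> = c * ig_const m * T powr (- m)"
      using ig_kernel_integral[OF \<open>T > 0\<close>] by simp
    finally show "marginal_likelihood \<mu> s1 s2 \<theta> D y =
       c * ig_const m * (s2 + (norm (y - mean_response \<mu> \<theta> D))\<^sup>2) powr (- ((s1 + real CARD('n)) / 2))"
      by (simp add: T_def m_def)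
  qed
qed

section \<open>Finite mass of the multivariate t kernel\<close>

text \<open>
  The Gaussian factorises over the coordinates, each contributing \<open>sqrt (2 * pi * \<gamma>)\<close>.
\<close>

lemma nn_integral_gaussian_norm:
  fixes \<gamma> :: real
  assumes "\<gamma> > 0"
  shows "(\<integral>\<^sup>+z. ennreal (exp (- (norm (z::'a::euclidean_space))\<^sup>2 / (2 * \<gamma>))) \<partial>lborel)
    = ennreal ((2 * pi * \<gamma>) powr (DIM('a) / 2))"
proof -
  let ?q = "\<lambda>x. exp (- x\<^sup>2 / (2 * \<gamma>))"
  have one: "(\<integral>\<^sup>+x. ennreal (?q x) \<partial>lborel) = ennreal ((2 * pi * \<gamma>) powr (1 / 2))"
  proof -
    have "?q x = (2 * pi * \<gamma>) powr (1 / 2) * normal_density 0 (sqrt \<gamma>) x" for x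
      using assms by (simp add: normal_density_def powr_half_sqrt)
    then have "(\<integral>\<^sup>+x. ennreal (?q x) \<partial>lborel)
       = (\<integral>\<^sup>+x. ennreal ((2 * pi * \<gamma>) powr (1 / 2)) * ennreal (normal_density 0 (sqrt \<gamma>) x) \<partial>lborel)"
      by (simp add: ennreal_mult)
    also have "\<dots> = ennreal ((2 * pi * \<gamma>) powr (1 / 2)) * (\<integral>\<^sup>+x. ennreal (normal_density 0 (sqrt \<gamma>) x) \<partial>lborel)"
      by (intro nn_integral_cmult) auto
    also have "(\<integral>\<^sup>+x. ennreal (normal_density 0 (sqrt \<gamma>) x) \<partial>lborel) = 1"
      using assms by (simp add: nn_integral_eq_integral)
    finally show ?thesis by simp
  qed
  have "exp (- (norm z)\<^sup>2 / (2 * \<gamma>)) = (\<Prod>b\<in>Basis. ?q (z \<bullet> b))" for z :: 'a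
  proof -
    have "(norm z)\<^sup>2 = (\<Sum>b\<in>Basis. (z \<bullet> b)\<^sup>2)"
      by (subst power2_norm_eq_inner, subst euclidean_inner) (simp add: power2_eq_square)
    then show ?thesis
      by (simp add: exp_sum[symmetric] sum_negf sum_divide_distrib)
  qed
  then have "(\<integral>\<^sup>+z. ennreal (exp (- (norm (z::'a))\<^sup>2 / (2 * \<gamma>))) \<partial>lborel)
    = (\<integral>\<^sup>+z. (\<Prod>b\<in>(Basis::'a set). ennreal (?q (z \<bullet> b))) \<partial>lborel)"
    by (simp add: prod_ennreal)
  also have "\<dots> = (\<Prod>b\<in>(Basis::'a set). (\<integral>\<^sup>+x. ennreal (?q x) \<partial>lborel))"
    by (intro nn_integral_lborel_prod) auto
  also have "\<dots> = ennreal (((2 * pi * \<gamma>) powr (1 / 2)) ^ DIM('a))"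
    by (simp add: one[simplified] ennreal_power)
  also have "((2 * pi * \<gamma>) powr (1 / 2)) ^ DIM('a) = (2 * pi * \<gamma>) powr (DIM('a) / 2)"
    using assms by (simp add: powr_realpow[symmetric] powr_powr)
  finally show ?thesis .
qed

text \<open>
  Writing the power as a scale mixture of Gaussians (\<open>ig_kernel_integral\<close> read backwards) and exchanging
  the order of integration by Tonelli turns the \<open>n\<close>-dimensional integral into a one-dimensional one: each
  Gaussian contributes \<open>(2 * pi * \<gamma>) powr (n / 2)\<close>, which lowers the exponent of the
  inverse-gamma kernel from \<open>(r + n) / 2\<close> to \<open>r / 2 > 0\<close>.
\<close>

lemma integrable_t_kernel:
  fixes s r :: real
  assumes r: "r > 0" and s: "s > 0"
  shows "integrable lborel (\<lambda>z::'a::euclidean_space. (s + (norm z)\<^sup>2) powr (- ((r + DIM('a)) / 2)))"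
proof -
  define m where "m = (r + DIM('a)) / 2"
  have m: "m > 0" using r by (simp add: m_def)
  define h where "h z \<gamma> = indicator {0<..} \<gamma> * (\<gamma> powr (-m - 1) * exp (- (s + (norm z)\<^sup>2) / (2 * \<gamma>)))"
    for z :: 'a and \<gamma> :: real
  have T: "s + (norm z)\<^sup>2 > 0" for z :: 'a using s by (simp add: add_pos_nonneg)
  have h_nonneg: "h z \<gamma> \<ge> 0" for z \<gamma> by (simp add: h_def)
  have h_meas[measurable]: "case_prod h \<in> borel_measurable (lborel \<Otimes>\<^sub>M lborel)"
    unfolding h_def case_prod_beta by measurable
  have inner_z: "(\<integral>\<^sup>+\<gamma>. ennreal (h z \<gamma>) \<partial>lborel) = ennreal ((s + (norm z)\<^sup>2) powr (-m) * ig_const m)" for z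
  proof -
    have "integrable lborel (h z)"
      using set_integrable_ig_kernel[OF m T[of z]] by (simp add: set_integrable_def h_def[abs_def])
    then have "(\<integral>\<^sup>+\<gamma>. ennreal (h z \<gamma>) \<partial>lborel) = ennreal (\<integral>\<gamma>. h z \<gamma> \<partial>lborel)"
      by (intro nn_integral_eq_integral) (auto simp: h_nonneg)
    then show ?thesis
      using ig_kernel_integral[OF T[of z], of m] by (simp add: set_lebesgue_integral_def h_def[abs_def])
  qed
  have inner_g: "(\<integral>\<^sup>+z. ennreal (h z \<gamma>) \<partial>lborel) =
     ennreal ((2 * pi) powr (DIM('a) / 2) * (indicator {0<..} \<gamma> * (\<gamma> powr (-(r/2) - 1) * exp (- s / (2 * \<gamma>)))))" for \<gamma>
  proof (cases "\<gamma> > 0")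
    case True
    have "h z \<gamma> = (\<gamma> powr (-m - 1) * exp (- s / (2 * \<gamma>))) * exp (- (norm z)\<^sup>2 / (2 * \<gamma>))" for z
      using True by (simp add: h_def mult_exp_exp add_divide_distrib[symmetric] diff_divide_distrib)
    then have "(\<integral>\<^sup>+z. ennreal (h z \<gamma>) \<partial>lborel) =
      (\<integral>\<^sup>+z. ennreal (\<gamma> powr (-m - 1) * exp (- s / (2 * \<gamma>))) * ennreal (exp (- (norm (z::'a))\<^sup>2 / (2 * \<gamma>))) \<partial>lborel)"
      by (simp add: ennreal_mult)
    also have "\<dots> = ennreal (\<gamma> powr (-m - 1) * exp (- s / (2 * \<gamma>))) * ennreal ((2 * pi * \<gamma>) powr (DIM('a) / 2))"
      by (simp add: nn_integral_cmult nn_integral_gaussian_norm[OF True, simplified])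
    also have "\<dots> = ennreal ((\<gamma> powr (-m - 1) * exp (- s / (2 * \<gamma>))) * (2 * pi * \<gamma>) powr (DIM('a) / 2))"
      by (simp add: ennreal_mult)
    also have "(\<gamma> powr (-m - 1) * exp (- s / (2 * \<gamma>))) * (2 * pi * \<gamma>) powr (DIM('a) / 2)
       = (2 * pi) powr (DIM('a) / 2) * (\<gamma> powr (-m - 1) * \<gamma> powr (DIM('a) / 2)) * exp (- s / (2 * \<gamma>))"
      using True by (simp add: powr_mult)
    also have "\<gamma> powr (-m - 1) * \<gamma> powr (DIM('a) / 2) = \<gamma> powr (-(r/2) - 1)"
      by (simp add: powr_add[symmetric] m_def field_simps)
    finally show ?thesis using True by (simp add: mult.assoc)
  qed (simp add: h_def)
  have "(\<integral>\<^sup>+z. ennreal ((s + (norm (z::'a))\<^sup>2) powr (-m) * ig_const m) \<partial>lborel)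
      = (\<integral>\<^sup>+\<gamma>. (\<integral>\<^sup>+z. ennreal (h z \<gamma>) \<partial>lborel) \<partial>lborel)"
    unfolding inner_z[symmetric] by (rule lborel_pair.Fubini'[symmetric]) measurable
  also have "\<dots> < \<infinity>"
  proof -
    have "integrable lborel (\<lambda>\<gamma>. (2 * pi) powr (DIM('a) / 2) * 
       (indicator {0<..} \<gamma> * (\<gamma> powr (-(r/2) - 1) * exp (- s / (2 * \<gamma>)))))"
      using set_integrable_ig_kernel[of "r / 2" s] r s by (simp add: set_integrable_def)
    then show ?thesis
      unfolding inner_g by (subst nn_integral_eq_integral) auto
  qed
  finally have "integrable lborel (\<lambda>z::'a. (s + (norm z)\<^sup>2) powr (-m) * ig_const m)"
    using ig_const_pos[OF m] by (intro integrableI_nonneg) auto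
  then show ?thesis
    using ig_const_pos[OF m] by (simp add: m_def)
qed

section \<open>Second moments of radial densities\<close>

lemma lborel_distr_reflection:
  fixes b :: "'a::euclidean_space"
  defines "R z \<equiv> (\<Sum>j\<in>Basis. ((if j = b then -1 else 1) * (z \<bullet> j)) *\<^sub>R j)"
  shows "distr lborel borel R = (lborel :: 'a measure)"
  using lborel_affine_euclidean[of "\<lambda>j. if j = b then -1 else 1" "0 :: 'a"]
  by (simp add: R_def[abs_def] if_distrib[of abs] density_1 cong: if_cong)

text \<open>
  The preimage of a box under a permutation of coordinates is the box with permuted sides, and boxes
  determine Lebesgue measure.
\<close>

lemma lborel_distr_permute:
  assumes bij: "bij_betw p Basis (Basis :: 'a::euclidean_space set)"
  defines "P z \<equiv> (\<Sum>j\<in>Basis. (z \<bullet> p j) *\<^sub>R j)"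
  shows "distr lborel borel P = (lborel :: 'a measure)"
proof (rule lborel_eqI[symmetric])
  fix l u :: 'a
  assume lu: "\<And>b. b \<in> Basis \<Longrightarrow> l \<bullet> b \<le> u \<bullet> b"
  define q where "q = inv_into Basis p"
  have q: "bij_betw q Basis Basis" unfolding q_def by (rule bij_betw_inv_into[OF bij])
  have pq: "p j \<in> Basis" "q j \<in> Basis" "p (q j) = j" "q (p j) = j" if "j \<in> Basis" for j
    using that bij q unfolding q_def
    by (auto simp: bij_betw_inv_into_left bij_betw_inv_into_right dest: bij_betwE)
  define Q where "Q z = (\<Sum>j\<in>Basis. (z \<bullet> q j) *\<^sub>R j)" for z :: 'a
  have Q: "Q z \<bullet> j = z \<bullet> q j" if "j \<in> Basis" for z j using that by (simp add: Q_def)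
  have P: "P z \<bullet> j = z \<bullet> p j" if "j \<in> Basis" for z j using that by (simp add: P_def)
  have [measurable]: "P \<in> borel_measurable borel" unfolding P_def[abs_def] by measurable
  have "P -` box l u = box (Q l) (Q u)"
  proof (intro set_eqI)
    fix z
    have "(\<forall>j\<in>Basis. l \<bullet> j < z \<bullet> p j \<and> z \<bullet> p j < u \<bullet> j) \<longleftrightarrow>
          (\<forall>j\<in>Basis. l \<bullet> q j < z \<bullet> j \<and> z \<bullet> j < u \<bullet> q j)"
      using pq by metis
    then show "z \<in> P -` box l u \<longleftrightarrow> z \<in> box (Q l) (Q u)"
      by (simp add: mem_box P Q)
  qed
  then have "emeasure (distr lborel borel P) (box l u) = emeasure lborel (box (Q l) (Q u))"
    by (simp add: emeasure_distr)
  also have "\<dots> = (\<Prod>j\<in>Basis. (u - l) \<bullet> q j)"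
    using lu pq by (subst emeasure_lborel_box) (auto simp: Q inner_diff_left)
  also have "(\<Prod>j\<in>Basis. (u - l) \<bullet> q j) = (\<Prod>j\<in>Basis. (u - l) \<bullet> j)"
    by (rule prod.reindex_bij_betw[OF q])
  finally show "emeasure (distr lborel borel P) (box l u) = (\<Prod>b\<in>Basis. (u - l) \<bullet> b)" .
qed simp

lemma norm_coordinates_eq:
  fixes x y :: "'a::euclidean_space"
  assumes "bij_betw p Basis (Basis :: 'a set)" "\<And>j. j \<in> Basis \<Longrightarrow> \<bar>x \<bullet> j\<bar> = \<bar>y \<bullet> p j\<bar>"
  shows "norm x = norm y"
proof -
  have "(\<Sum>j\<in>Basis. (x \<bullet> j)\<^sup>2) = (\<Sum>j\<in>Basis. (y \<bullet> p j)\<^sup>2)"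
    using assms(2) by (intro sum.cong) (auto simp: power2_eq_iff abs_eq_iff)
  also have "\<dots> = (\<Sum>j\<in>Basis. (y \<bullet> j)\<^sup>2)"
    by (rule sum.reindex_bij_betw[OF assms(1)])
  finally show ?thesis
    by (simp add: norm_eq_sqrt_inner euclidean_inner[of x x] euclidean_inner[of y y] power2_eq_square)
qed

text \<open>
  Reflecting the coordinate \<open>b\<close> preserves Lebesgue measure and the norm but flips the sign of the integrand.
\<close>

lemma radial_cross_moment:
  fixes g :: "real \<Rightarrow> real"
  assumes [measurable]: "g \<in> borel_measurable borel"
    and b: "b \<in> Basis" "b' \<in> Basis" "b \<noteq> (b' :: 'a::euclidean_space)"
  shows "(\<integral>z. (z \<bullet> b) * (z \<bullet> b') * g (norm z) \<partial>lborel) = 0"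
proof -
  define R :: "'a \<Rightarrow> 'a" where "R z = (\<Sum>j\<in>Basis. ((if j = b then -1 else 1) * (z \<bullet> j)) *\<^sub>R j)" for z
  have [measurable]: "R \<in> borel_measurable borel" unfolding R_def[abs_def] by measurable
  have R: "R z \<bullet> j = (if j = b then -1 else 1) * (z \<bullet> j)" if "j \<in> Basis" for z j
    using that by (simp add: R_def)
  have norm_R: "norm (R z) = norm z" for z
    by (rule norm_coordinates_eq[of id]) (auto simp: R)
  have "(\<integral>z. (z \<bullet> b) * (z \<bullet> b') * g (norm z) \<partial>lborel)
      = (\<integral>z. (z \<bullet> b) * (z \<bullet> b') * g (norm z) \<partial>distr lborel borel R)"
    using lborel_distr_reflection[of b] by (simp add: R_def[abs_def])
  also have "\<dots> = (\<integral>z. (R z \<bullet> b) * (R z \<bullet> b') * g (norm (R z)) \<partial>lborel)"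
    by (rule integral_distr) measurable
  also have "\<dots> = - (\<integral>z. (z \<bullet> b) * (z \<bullet> b') * g (norm z) \<partial>lborel)"
    using b by (simp add: R norm_R)
  finally show ?thesis by simp
qed

text \<open>
  Swapping the coordinates \<open>b\<close> and \<open>b'\<close> preserves Lebesgue measure and the norm.
\<close>

lemma radial_coordinate_moment_cong:
  fixes g :: "real \<Rightarrow> real" and b b' :: "'a::euclidean_space"
  assumes [measurable]: "g \<in> borel_measurable borel"
    and b: "b \<in> Basis" "b' \<in> Basis"
  shows "(\<integral>z. (z \<bullet> b)\<^sup>2 * g (norm z) \<partial>lborel) = (\<integral>z. (z \<bullet> b')\<^sup>2 * g (norm z) \<partial>lborel)"
proof -
  define p where "p = Transposition.transpose b b'"
  have bij: "bij_betw p Basis Basis"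
    unfolding p_def using b by (simp add: bij_betw_transpose_iff)
  define P :: "'a \<Rightarrow> 'a" where "P z = (\<Sum>j\<in>Basis. (z \<bullet> p j) *\<^sub>R j)" for z
  have [measurable]: "P \<in> borel_measurable borel" unfolding P_def[abs_def] by measurable
  have P: "P z \<bullet> j = z \<bullet> p j" if "j \<in> Basis" for z j
    using that by (simp add: P_def)
  have norm_P: "norm (P z) = norm z" for z
    by (rule norm_coordinates_eq[OF bij]) (auto simp: P)
  have "(\<integral>z. (z \<bullet> b)\<^sup>2 * g (norm z) \<partial>lborel) = (\<integral>z. (z \<bullet> b)\<^sup>2 * g (norm z) \<partial>distr lborel borel P)"
    using lborel_distr_permute[OF bij] by (simp add: P_def[abs_def])
  also have "\<dots> = (\<integral>z. (P z \<bullet> b)\<^sup>2 * g (norm (P z)) \<partial>lborel)"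
    by (rule integral_distr) measurable
  finally show ?thesis
    using b by (simp add: P norm_P p_def)
qed

text \<open>
  The second-moment matrix of a radial density is a multiple of the identity: off-diagonal entries vanish by
  reflection, diagonal entries agree by permutation, and their sum is the integral of \<open>(norm z)\<^sup>2 * g (norm z)\<close>.
  Hence the quadratic form \<open>a \<mapsto> E[(a \<bullet> z)\<^sup>2]\<close> sees only the length of \<open>a\<close>.
\<close>

lemma radial_second_moment:
  fixes a :: "'a::euclidean_space" and g :: "real \<Rightarrow> real"
  assumes g[measurable]: "g \<in> borel_measurable borel"
    and int: "integrable lborel (\<lambda>z::'a. (norm z)\<^sup>2 * g (norm z))"
  shows "(\<integral>z. (a \<bullet> z)\<^sup>2 * g (norm z) \<partial>lborel)
    = (norm a)\<^sup>2 * ((\<integral>z. (norm (z::'a))\<^sup>2 * g (norm z) \<partial>lborel) / DIM('a))"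
proof -
  define M where "M b b' = (\<integral>z. ((z::'a) \<bullet> b) * (z \<bullet> b') * g (norm z) \<partial>lborel)" for b b'
  define K where "K = (\<integral>z. (norm (z::'a))\<^sup>2 * g (norm z) \<partial>lborel) / DIM('a)"
  have int_bb: "integrable lborel (\<lambda>z::'a. (z \<bullet> b) * (z \<bullet> b') * g (norm z))"
    if "b \<in> Basis" "b' \<in> Basis" for b b'
  proof (rule Bochner_Integration.integrable_bound[OF int])
    show "AE z in lborel. norm ((z \<bullet> b) * (z \<bullet> b') * g (norm z)) \<le> norm ((norm z)\<^sup>2 * g (norm z))"
      using that by (intro AE_I2)
        (auto simp: abs_mult power2_eq_square intro!: mult_mono Basis_le_norm)
  qed measurable
  have sq: "(norm z)\<^sup>2 = (\<Sum>b\<in>Basis. (z \<bullet> b) * (z \<bullet> b))" for z :: 'a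
    by (subst power2_norm_eq_inner, subst euclidean_inner) simp
  have diag: "M b b = K" if b: "b \<in> Basis" for b
  proof -
    have "(\<integral>z. (norm (z::'a))\<^sup>2 * g (norm z) \<partial>lborel) = (\<Sum>b'\<in>Basis. M b' b')"
      unfolding sq sum_distrib_right M_def by (intro Bochner_Integration.integral_sum int_bb)
    also have "\<dots> = (\<Sum>b'\<in>(Basis::'a set). M b b)"
      using radial_coordinate_moment_cong[OF g _ b]
      by (intro sum.cong) (auto simp: M_def power2_eq_square)
    finally show ?thesis by (simp add: K_def)
  qed
  have cross: "M b b' = 0" if "b \<in> Basis" "b' \<in> Basis" "b \<noteq> b'" for b b'
    unfolding M_def by (rule radial_cross_moment[OF g that])
  have "(a \<bullet> z)\<^sup>2 * g (norm z)
      = (\<Sum>b\<in>Basis. \<Sum>b'\<in>Basis. (a \<bullet> b) * (a \<bullet> b') * ((z \<bullet> b) * (z \<bullet> b') * g (norm z)))" for z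
  proof -
    have "(a \<bullet> z)\<^sup>2 = (\<Sum>b\<in>Basis. \<Sum>b'\<in>Basis. ((a \<bullet> b) * (z \<bullet> b)) * ((a \<bullet> b') * (z \<bullet> b')))"
      by (simp only: euclidean_inner[of a z] power2_eq_square sum_product)
    then show ?thesis
      by (simp only: sum_distrib_right) (intro sum.cong refl, simp only: mult_ac)
  qed
  then have "(\<integral>z. (a \<bullet> z)\<^sup>2 * g (norm z) \<partial>lborel)
      = (\<Sum>b\<in>Basis. \<Sum>b'\<in>Basis. (a \<bullet> b) * (a \<bullet> b') * M b b')"
    unfolding M_def by (simp add: Bochner_Integration.integral_sum int_bb)
  also have "\<dots> = (\<Sum>b\<in>Basis. \<Sum>b'\<in>Basis. if b = b' then (a \<bullet> b) * (a \<bullet> b) * K else 0)"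
    using diag cross by (intro sum.cong) auto
  also have "\<dots> = (norm a)\<^sup>2 * K"
    by (simp add: sq sum_distrib_right)
  finally show ?thesis by (simp add: K_def)
qed

text \<open>
  This is the moment that controls the variance of the score. The factor
  \<open>(norm z)\<^sup>2 / (s + (norm z)\<^sup>2)\<^sup>2\<close> is at most \<open>1 / s\<close>, so the t kernel itself dominates;
  the integrand vanishes only at the origin, so the integral is
  not zero.
\<close>

lemma t_second_moment:
  fixes r s :: real
  assumes r: "r > 0" and s: "s > 0"
  defines "f z \<equiv> (norm z)\<^sup>2 * ((s + (norm z)\<^sup>2) powr (- ((r + DIM('a)) / 2)) / (s + (norm z)\<^sup>2)\<^sup>2)"
  shows "integrable lborel (f :: 'a::euclidean_space \<Rightarrow> real)" and "integral\<^sup>L lborel (f :: 'a \<Rightarrow> real) > 0"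
proof -
  have T: "s + (norm z)\<^sup>2 > 0" for z :: 'a using s by (simp add: add_pos_nonneg)
  show int: "integrable lborel (f :: 'a \<Rightarrow> real)"
  proof (rule Bochner_Integration.integrable_bound)
    show "integrable lborel (\<lambda>z::'a. (1 / s) * (s + (norm z)\<^sup>2) powr (- ((r + DIM('a)) / 2)))"
      using integrable_t_kernel[OF r s, where 'a = 'a] by simp
    show "AE z::'a in lborel. norm (f z) \<le> norm ((1 / s) * (s + (norm z)\<^sup>2) powr (- ((r + DIM('a)) / 2)))"
    proof (rule AE_I2)
      fix z :: 'a
      define w where "w = (s + (norm z)\<^sup>2) powr (- ((r + DIM('a)) / 2))"
      have "(norm z)\<^sup>2 * s \<le> (s + (norm z)\<^sup>2) * (s + (norm z)\<^sup>2)"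
        using s by (intro mult_mono) auto
      then have "(norm z)\<^sup>2 / (s + (norm z)\<^sup>2)\<^sup>2 \<le> 1 / s"
        using s T[of z] by (simp add: divide_le_eq le_divide_eq power2_eq_square)
      then have "(norm z)\<^sup>2 / (s + (norm z)\<^sup>2)\<^sup>2 * w \<le> 1 / s * w"
        by (intro mult_right_mono) (auto simp: w_def)
      moreover have "w \<ge> 0" by (simp add: w_def)
      ultimately show "norm (f z) \<le> norm ((1 / s) * (s + (norm z)\<^sup>2) powr (- ((r + DIM('a)) / 2)))"
        unfolding w_def[symmetric] f_def using s by (simp add: abs_mult mult.commute)
    qed
  qed (simp add: f_def[abs_def])
  have nonneg: "AE z::'a in lborel. 0 \<le> f z" by (rule AE_I2) (auto simp: f_def)
  have "integral\<^sup>L lborel (f :: 'a \<Rightarrow> real) \<noteq> 0"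
  proof
    assume "integral\<^sup>L lborel (f :: 'a \<Rightarrow> real) = 0"
    then have "AE z::'a in lborel. f z = 0"
      using integral_nonneg_eq_0_iff_AE[OF int nonneg] by simp
    moreover have zero: "z = 0" if "f z = 0" for z :: 'a
    proof -
      have "s + (norm z)\<^sup>2 \<noteq> 0" using T[of z] by simp
      then show ?thesis using that by (simp add: f_def)
    qed
    ultimately have "AE z::'a in lborel. z = 0" by (rule eventually_mono)
    moreover have "AE z::'a in lborel. z \<noteq> 0"
      by (rule AE_lborel_singleton)
    ultimately have "AE z::'a in lborel. False" by eventually_elim auto
    then show False by (subst (asm) AE_iff_measurable[of UNIV]) auto
  qed
  then show "integral\<^sup>L lborel (f :: 'a \<Rightarrow> real) > 0"
    using integral_nonneg_AE[OF nonneg] by linarith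
qed

section \<open>Measurability of partial derivatives\<close>

lemma frechet_directional_derivative:
  fixes f :: "'a::real_normed_vector \<Rightarrow> real"
  assumes "(f has_derivative f') (at \<theta>)"
  shows "((\<lambda>h. f (\<theta> + h *\<^sub>R v)) has_real_derivative f' v) (at 0)"
proof -
  interpret bounded_linear f' by (rule has_derivative_bounded_linear[OF assms])
  have "((\<lambda>h. \<theta> + h *\<^sub>R v) has_derivative (\<lambda>h. h *\<^sub>R v)) (at (0::real))"
    by (auto intro!: derivative_eq_intros)
  then have "((\<lambda>h. f (\<theta> + h *\<^sub>R v)) has_derivative (\<lambda>h. f' (h *\<^sub>R v))) (at 0)"
    by (rule has_derivative_compose) (simp add: assms)
  then show ?thesis
    by (simp add: has_field_derivative_def scaleR mult_commute_abs)
qed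

lemma partial_deriv_eq:
  assumes "(f has_derivative f') (at \<theta>)"
  shows "partial_deriv f \<theta> j = f' (axis j 1)"
  unfolding partial_deriv_def by (rule DERIV_imp_deriv[OF frechet_directional_derivative[OF assms]])

lemma partial_deriv_has_derivative:
  assumes "f differentiable (at \<theta>)"
  shows "((\<lambda>h. f (\<theta> + h *\<^sub>R axis j 1)) has_real_derivative partial_deriv f \<theta> j) (at 0)"
  using assms unfolding differentiable_def
  by (metis frechet_directional_derivative partial_deriv_eq)

text \<open>
  For an arbitrary function \<open>f\<close> the supremum over a moving open ball is lower semicontinuous: a value above \<open>c\<close>
  at \<open>y\<close> pushes the supremum above \<open>c\<close> at every centre whose ball contains \<open>y\<close>, and these centres form
  an open set. The values are extended reals because \<open>f\<close> may be unbounded on the ball.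
\<close>

lemma lower_semicontinuous_local_Sup:
  fixes f :: "'a::euclidean_space \<Rightarrow> real"
  shows "(\<lambda>x. SUP y\<in>ball (x + v) r. ereal (f y)) \<in> borel_measurable borel"
proof (rule borel_measurableI_greater)
  fix c :: ereal
  have dist: "dist (x + v) y = dist (y - v) x" for x y
    by (simp add: dist_norm norm_minus_commute[of _ y] diff_diff_eq add.commute)
  have "{x \<in> space borel. c < (SUP y\<in>ball (x + v) r. ereal (f y))}
      = (\<Union>y\<in>{y. c < ereal (f y)}. ball (y - v) r)"
    by (auto simp: less_SUP_iff dist)
  also have "open \<dots>" by auto
  finally show "{x \<in> space borel. c < (SUP y\<in>ball (x + v) r. ereal (f y))} \<in> sets borel"
    by simp
qed

text \<open>
  In the difference quotient in direction \<open>e\<close> with step \<open>h\<close>, the value \<open>f (x + h e)\<close> may be replaced by the supremum of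
  \<open>f\<close> over a ball of radius \<open>h\<^sup>2\<close> around that point. By total differentiability the values on this ball differ
  from \<open>f x + h * f' e\<close> by \<open>o(h)\<close>: the linear part moves by at most \<open>O(h\<^sup>2)\<close>, and the remainder is \<open>o(h)\<close>
  because the whole ball lies within \<open>2 * h\<close> of \<open>x\<close>.
\<close>

lemma local_Sup_quotient_tendsto:
  fixes f :: "'a::euclidean_space \<Rightarrow> real" and e x :: 'a
  assumes f': "(f has_derivative f') (at x)" and e: "norm e \<le> 1"
  defines "h n \<equiv> 1 / real (Suc n)"
  shows "(\<lambda>n. (real_of_ereal (SUP y\<in>ball (x + h n *\<^sub>R e) ((h n)\<^sup>2). ereal (f y)) - f x) / h n) \<longlonglongrightarrow> f' e"
proof (rule LIMSEQ_I)
  fix \<epsilon> :: real assume "\<epsilon> > 0"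
  interpret bounded_linear f' by (rule has_derivative_bounded_linear[OF f'])
  obtain B where B: "B > 0" "\<And>v. \<bar>f' v\<bar> \<le> norm v * B"
    using pos_bounded by auto
  have h: "0 < h n" "h n \<le> 1" for n by (auto simp: h_def)
  have hlim: "h \<longlonglongrightarrow> 0" unfolding h_def by (rule LIMSEQ_Suc[OF lim_1_over_n])
  obtain \<delta> where \<delta>: "\<delta> > 0"
    "\<And>y. norm (y - x) < \<delta> \<Longrightarrow> \<bar>f y - f x - f' (y - x)\<bar> \<le> \<epsilon> / 8 * norm (y - x)"
    using f'[unfolded has_derivative_at_alt, THEN conjunct2, rule_format, of "\<epsilon> / 8"] \<open>\<epsilon> > 0\<close> by auto
  have "\<forall>\<^sub>F n in sequentially. h n < min (\<delta> / 2) (\<epsilon> / (4 * B))"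
    using \<delta>(1) B(1) \<open>\<epsilon> > 0\<close> by (intro order_tendstoD(2)[OF hlim]) auto
  then obtain N where N: "\<And>n. n \<ge> N \<Longrightarrow> h n < \<delta> / 2 \<and> h n < \<epsilon> / (4 * B)"
    by (auto simp: eventually_sequentially)
  show "\<exists>N. \<forall>n\<ge>N. norm ((real_of_ereal (SUP y\<in>ball (x + h n *\<^sub>R e) ((h n)\<^sup>2). ereal (f y)) - f x) / h n - f' e) < \<epsilon>"
  proof (intro exI allI impI)
    fix n assume "n \<ge> N"
    define S where "S = (SUP y\<in>ball (x + h n *\<^sub>R e) ((h n)\<^sup>2). ereal (f y))"
    have est: "\<bar>f y - (f x + h n * f' e)\<bar> \<le> \<epsilon> / 2 * h n" if y: "y \<in> ball (x + h n *\<^sub>R e) ((h n)\<^sup>2)" for y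
    proof -
      define w where "w = y - (x + h n *\<^sub>R e)"
      have w: "norm w \<le> (h n)\<^sup>2"
        using y by (simp add: w_def dist_norm norm_minus_commute)
      have "(h n)\<^sup>2 \<le> h n" using h[of n] by (simp add: power2_eq_square mult_left_le)
      moreover have yx: "y - x = h n *\<^sub>R e + w" by (simp add: w_def)
      moreover have "norm (h n *\<^sub>R e) \<le> h n" using h[of n] e by (simp add: mult_left_le)
      ultimately have "norm (y - x) \<le> 2 * h n"
        unfolding yx using w norm_triangle_ineq[of "h n *\<^sub>R e" w] by linarith
      then have "norm (y - x) < \<delta>" and "\<epsilon> / 8 * norm (y - x) \<le> \<epsilon> / 8 * (2 * h n)"
        using N[OF \<open>n \<ge> N\<close>] \<open>\<epsilon> > 0\<close> by (linarith, intro mult_left_mono) auto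
      then have "\<bar>f y - f x - f' (y - x)\<bar> \<le> \<epsilon> / 8 * (2 * h n)"
        using \<delta>(2)[of y] by linarith
      moreover have "f' (y - x) = h n * f' e + f' w"
        by (simp add: yx add scaleR)
      moreover have "\<bar>f' w\<bar> \<le> \<epsilon> / 4 * h n"
      proof -
        have "\<bar>f' w\<bar> \<le> norm w * B" by (rule B(2))
        also have "\<dots> \<le> (h n)\<^sup>2 * B" using w B(1) by (intro mult_right_mono) auto
        also have "\<dots> = (h n * B) * h n" by (simp add: power2_eq_square)
        also have "\<dots> \<le> \<epsilon> / 4 * h n"
          using N[OF \<open>n \<ge> N\<close>] B(1) h[of n] by (intro mult_right_mono) (auto simp: field_simps)
        finally show ?thesis .
      qed
      moreover have "\<epsilon> / 8 * (2 * h n) + \<epsilon> / 4 * h n = \<epsilon> / 2 * h n" by simp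
      ultimately show ?thesis by linarith
    qed
    have "S \<le> ereal (f x + h n * f' e + \<epsilon> / 2 * h n)"
      unfolding S_def
    proof (rule SUP_least)
      fix y assume "y \<in> ball (x + h n *\<^sub>R e) ((h n)\<^sup>2)"
      then show "ereal (f y) \<le> ereal (f x + h n * f' e + \<epsilon> / 2 * h n)"
        using est[of y] unfolding ereal_less_eq by linarith
    qed
    moreover
    have c: "x + h n *\<^sub>R e \<in> ball (x + h n *\<^sub>R e) ((h n)\<^sup>2)" using h[of n] by simp
    have "f x + h n * f' e - \<epsilon> / 2 * h n \<le> f (x + h n *\<^sub>R e)"
      using est[OF c] by linarith
    then have "ereal (f x + h n * f' e - \<epsilon> / 2 * h n) \<le> S"
      unfolding S_def by (intro SUP_upper2[OF c]) simp
    ultimately obtain s where s: "S = ereal s"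
      and "f x + h n * f' e - \<epsilon> / 2 * h n \<le> s" "s \<le> f x + h n * f' e + \<epsilon> / 2 * h n"
      by (cases S) auto
    then have s_est: "\<bar>s - (f x + h n * f' e)\<bar> \<le> \<epsilon> / 2 * h n" by linarith
    have "(s - f x) / h n - f' e = (s - (f x + h n * f' e)) / h n"
      using h[of n] by (simp add: field_simps)
    also have "\<bar>\<dots>\<bar> \<le> \<epsilon> / 2"
      using s_est h[of n] by (simp add: abs_divide divide_le_eq)
    finally show "norm ((real_of_ereal S - f x) / h n - f' e) < \<epsilon>"
      using s \<open>\<epsilon> > 0\<close> by simp
  qed
qed

text \<open>
  The usual argument, that a derivative is a limit of measurable difference quotients, fails here:
  \<open>\<theta> + h *\<^sub>R e\<close> may leave \<open>\<Theta>\<close>, where \<open>f\<close> can be arbitrary. Replacing the outer value by a local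
  supremum repairs measurability without changing the limit, for any set \<open>\<Theta>\<close> at all.
\<close>

lemma partial_deriv_measurable:
  fixes f :: "real ^ 'p \<Rightarrow> real"
  assumes diff: "\<And>\<theta>. \<theta> \<in> \<Theta> \<Longrightarrow> f differentiable (at \<theta>)"
  shows "(\<lambda>\<theta>. partial_deriv f \<theta> j) \<in> borel_measurable (restrict_space borel \<Theta>)"
proof -
  let ?e = "axis j 1 :: real ^ 'p" and ?h = "\<lambda>n. 1 / real (Suc n)"
  let ?S = "\<lambda>n \<theta>. SUP y\<in>ball (\<theta> + ?h n *\<^sub>R ?e) ((?h n)\<^sup>2). ereal (f y)"
  show ?thesis
  proof (rule borel_measurable_LIMSEQ_metric)
    fix n
    have "continuous_on \<Theta> f"
      using diff by (intro differentiable_imp_continuous_on)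
        (auto simp: differentiable_on_def intro: differentiable_at_withinI)
    then have "f \<in> borel_measurable (restrict_space borel \<Theta>)"
      by (rule borel_measurable_continuous_on_restrict)
    moreover have "?S n \<in> borel_measurable (restrict_space borel \<Theta>)"
      by (intro measurable_restrict_space1 lower_semicontinuous_local_Sup)
    ultimately show "(\<lambda>\<theta>. (real_of_ereal (?S n \<theta>) - f \<theta>) / ?h n) \<in> borel_measurable (restrict_space borel \<Theta>)"
      by (intro borel_measurable_divide borel_measurable_diff borel_measurable_real_of_ereal) auto
  next
    fix \<theta> assume "\<theta> \<in> space (restrict_space borel \<Theta>)"
    then have "\<theta> \<in> \<Theta>" by (simp add: space_restrict_space)
    then obtain f' where f': "(f has_derivative f') (at \<theta>)"
      using diff unfolding differentiable_def by blast
    show "(\<lambda>n. (real_of_ereal (?S n \<theta>) - f \<theta>) / ?h n) \<longlonglongrightarrow> partial_deriv f \<theta> j"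
      unfolding partial_deriv_eq[OF f'] by (rule local_Sup_quotient_tendsto[OF f']) simp
  qed
qed

section \<open>Score and Fisher information\<close>

text \<open>
  Up to a constant, the log marginal likelihood is \<open>- (s1 + n) / 2 * ln (s2 + S)\<close> with \<open>S\<close> the residual sum of squares;
  this is the chain rule.
\<close>

lemma score_eq:
  fixes D :: "real ^ 'k ^ 'n" and \<theta> :: "real ^ 'p"
  assumes s: "s1 > 0" "s2 > 0"
    and diff: "\<And>i. (\<lambda>t. \<mu> t (D $ i)) differentiable (at \<theta>)"
  shows "score \<mu> s1 s2 \<theta> D y $ j =
    (s1 + real CARD('n)) / (s2 + (norm (y - mean_response \<mu> \<theta> D))\<^sup>2) *
    ((\<chi> i. partial_deriv (\<lambda>t. \<mu> t (D $ i)) \<theta> j) \<bullet> (y - mean_response \<mu> \<theta> D))"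
proof -
  let ?v = "axis j 1 :: real ^ 'p" and ?m = "(s1 + real CARD('n)) / 2"
  let ?d = "\<lambda>i. partial_deriv (\<lambda>t. \<mu> t (D $ i)) \<theta> j"
  let ?T = "\<lambda>t. s2 + (norm (y - mean_response \<mu> t D))\<^sup>2"
  obtain C where C: "C > 0"
    "\<And>\<theta>. marginal_likelihood \<mu> s1 s2 \<theta> D y = C * ?T \<theta> powr (- ?m)"
    using marginal_likelihood_eq[OF s, where 'p = 'p and 'k = 'k and 'n = 'n] by metis
  have T: "?T t > 0" for t using s by (simp add: add_pos_nonneg)
  have T_sum: "?T t = s2 + (\<Sum>i\<in>UNIV. (y $ i - \<mu> t (D $ i))\<^sup>2)" for t
    by (simp add: norm_vec_def L2_set_def sum_nonneg mean_response_def)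
  have ln_eq: "ln (marginal_likelihood \<mu> s1 s2 t D y) = ln C - ?m * ln (?T t)" for t
    using C T[of t] by (simp add: ln_mult ln_powr)
  have "((\<lambda>h. ?T (\<theta> + h *\<^sub>R ?v)) has_real_derivative
      (\<Sum>i\<in>UNIV. 2 * (y $ i - \<mu> \<theta> (D $ i)) * (- ?d i))) (at 0)"
    unfolding T_sum
    by (rule derivative_eq_intros partial_deriv_has_derivative[OF diff] refl)+ (simp add: algebra_simps)
  moreover have "0 < ?T (\<theta> + 0 *\<^sub>R ?v)" by (rule T)
  ultimately have "((\<lambda>h. ln (?T (\<theta> + h *\<^sub>R ?v))) has_real_derivative
      1 / ?T (\<theta> + 0 *\<^sub>R ?v) * (\<Sum>i\<in>UNIV. 2 * (y $ i - \<mu> \<theta> (D $ i)) * (- ?d i))) (at 0)"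
    by (intro DERIV_chain2[OF DERIV_ln_divide])
  from DERIV_diff[OF DERIV_const[of "ln C"] DERIV_cmult[OF this, of ?m]]
  have "((\<lambda>h. ln C - ?m * ln (?T (\<theta> + h *\<^sub>R ?v))) has_real_derivative
      - (?m * ((\<Sum>i\<in>UNIV. 2 * (y $ i - \<mu> \<theta> (D $ i)) * (- ?d i)) / ?T \<theta>))) (at 0)"
    by simp
  then have "score \<mu> s1 s2 \<theta> D y $ j = - (?m * ((\<Sum>i\<in>UNIV. 2 * (y $ i - \<mu> \<theta> (D $ i)) * (- ?d i)) / ?T \<theta>))"
    by (simp add: score_def partial_deriv_def ln_eq DERIV_imp_deriv)
  also have "(\<Sum>i\<in>UNIV. 2 * (y $ i - \<mu> \<theta> (D $ i)) * (- ?d i))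
      = - 2 * ((\<chi> i. ?d i) \<bullet> (y - mean_response \<mu> \<theta> D))"
    unfolding inner_vec_def mean_response_def sum_distrib_left
    by (intro sum.cong) (simp_all add: algebra_simps)
  finally show ?thesis by simp
qed

text \<open>
  After centring the responses, the square of a score component is the square of a linear functional of the
  residual times a radial weight, and its expectation against the radial t density is given by
  \<open>radial_second_moment\<close>. Each run contributes separately because only the squared length of the gradient
  vector \<open>(\<partial>\<mu>(\<theta>, d\<^sub>i)/\<partial>\<theta>\<^sub>j)\<^sub>i\<close> survives.
\<close>

lemma trace_fisher_information:
  fixes s1 s2 :: real
  assumes s: "s1 > 0" "s2 > 0"
  shows "\<exists>c>0. \<forall>(\<mu> :: real ^ 'p \<Rightarrow> real ^ 'k \<Rightarrow> real) \<theta> (D :: real ^ 'k ^ 'n).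
       (\<forall>i. (\<lambda>t. \<mu> t (D $ i)) differentiable (at \<theta>)) \<longrightarrow>
       trace (fisher_information \<mu> s1 s2 \<theta> D) =
       c * (\<Sum>i\<in>UNIV. \<Sum>j\<in>UNIV. (partial_deriv (\<lambda>t. \<mu> t (D $ i)) \<theta> j)\<^sup>2)"
proof -
  let ?N = "real CARD('n)"
  obtain C where C: "C > 0"
    "\<And>(\<mu> :: real ^ 'p \<Rightarrow> real ^ 'k \<Rightarrow> real) \<theta> (D :: real ^ 'k ^ 'n) y.
       marginal_likelihood \<mu> s1 s2 \<theta> D y =
       C * (s2 + (norm (y - mean_response \<mu> \<theta> D))\<^sup>2) powr (- ((s1 + ?N) / 2))"
    using marginal_likelihood_eq[OF s, where 'p = 'p and 'k = 'k and 'n = 'n] by metis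
  define g where "g r = (s2 + r\<^sup>2) powr (- ((s1 + ?N) / 2)) / (s2 + r\<^sup>2)\<^sup>2" for r :: real
  have g_meas[measurable]: "g \<in> borel_measurable borel" unfolding g_def[abs_def] by measurable
  define K where "K = (\<integral>z. (norm (z :: real ^ 'n))\<^sup>2 * g (norm z) \<partial>lborel) / ?N"
  have int: "integrable lborel (\<lambda>z :: real ^ 'n. (norm z)\<^sup>2 * g (norm z))" and "K > 0"
    using t_second_moment[OF s, where 'a = "real ^ 'n"] by (auto simp: g_def[abs_def] K_def)
  show ?thesis
  proof (intro exI[of _ "C * (s1 + ?N)\<^sup>2 * K"] conjI allI impI)
    show "C * (s1 + ?N)\<^sup>2 * K > 0" using C(1) \<open>K > 0\<close> s by simp
    fix \<mu> :: "real ^ 'p \<Rightarrow> real ^ 'k \<Rightarrow> real" and \<theta> and D :: "real ^ 'k ^ 'n"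
    assume "\<forall>i. (\<lambda>t. \<mu> t (D $ i)) differentiable (at \<theta>)"
    then have diff: "\<And>i. (\<lambda>t. \<mu> t (D $ i)) differentiable (at \<theta>)" by blast
    let ?M = "mean_response \<mu> \<theta> D"
    define a where "a j = (\<chi> i. partial_deriv (\<lambda>t. \<mu> t (D $ i)) \<theta> j)" for j
    have score: "score \<mu> s1 s2 \<theta> D y $ j = (s1 + ?N) / (s2 + (norm (y - ?M))\<^sup>2) * (a j \<bullet> (y - ?M))" for y j
      unfolding a_def by (rule score_eq[where \<mu> = \<mu> and \<theta> = \<theta> and D = D, OF s diff])
    have diag: "fisher_information \<mu> s1 s2 \<theta> D $ j $ j = C * (s1 + ?N)\<^sup>2 * K * (norm (a j))\<^sup>2" for j
    proof -
      define F where "F z = C * (s1 + ?N)\<^sup>2 * ((a j \<bullet> z)\<^sup>2 * g (norm z))" for z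
      have [measurable]: "F \<in> borel_measurable borel" unfolding F_def[abs_def] by measurable
      have "fisher_information \<mu> s1 s2 \<theta> D $ j $ j
          = (\<integral>y. marginal_likelihood \<mu> s1 s2 \<theta> D y *\<^sub>R (score \<mu> s1 s2 \<theta> D y $ j * score \<mu> s1 s2 \<theta> D y $ j) \<partial>lborel)"
        unfolding fisher_information_def response_distr_def
        using C(1) by (simp add: score C(2)) (subst integral_density, auto)
      also have "\<dots> = (\<integral>y. F (y - ?M) \<partial>lborel)"
        by (simp add: score C(2) F_def g_def power2_eq_square field_simps)
      also have "\<dots> = (\<integral>y. F (y - ?M) \<partial>distr lborel borel ((+) ?M))"
        by (simp add: lborel_distr_plus)
      also have "\<dots> = (\<integral>z. F z \<partial>lborel)"
        by (subst integral_distr) auto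
      also have "\<dots> = C * (s1 + ?N)\<^sup>2 * K * (norm (a j))\<^sup>2"
        using radial_second_moment[OF g_meas int, of "a j"] by (simp add: F_def K_def)
      finally show ?thesis .
    qed
    have "trace (fisher_information \<mu> s1 s2 \<theta> D) = C * (s1 + ?N)\<^sup>2 * K * (\<Sum>j\<in>UNIV. (norm (a j))\<^sup>2)"
      by (simp add: trace_def diag sum_distrib_left)
    also have "(\<Sum>j\<in>UNIV. (norm (a j))\<^sup>2) = (\<Sum>j\<in>UNIV. \<Sum>i\<in>UNIV. (partial_deriv (\<lambda>t. \<mu> t (D $ i)) \<theta> j)\<^sup>2)"
      by (simp add: a_def norm_vec_def L2_set_def sum_nonneg)
    also have "\<dots> = (\<Sum>i\<in>UNIV. \<Sum>j\<in>UNIV. (partial_deriv (\<lambda>t. \<mu> t (D $ i)) \<theta> j)\<^sup>2)"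
      by (rule sum.swap)
    finally show "trace (fisher_information \<mu> s1 s2 \<theta> D) =
       C * (s1 + ?N)\<^sup>2 * K * (\<Sum>i\<in>UNIV. \<Sum>j\<in>UNIV. (partial_deriv (\<lambda>t. \<mu> t (D $ i)) \<theta> j)\<^sup>2)" .
  qed
qed

section \<open>Optimal designs\<close>

text \<open>
  A coordinate that fails to maximise \<open>f\<close> can be exchanged for a better one without touching the others.
\<close>

lemma is_arg_max_separable_sum:
  fixes f :: "'a \<Rightarrow> real" and x :: "'a ^ 'n"
  assumes c: "c > 0"
    and U: "\<And>x :: 'a ^ 'n. (\<forall>i. x $ i \<in> A) \<Longrightarrow> U x = c * (\<Sum>i\<in>UNIV. f (x $ i))"
  shows "is_arg_max U (\<lambda>x. \<forall>i. x $ i \<in> A) x \<longleftrightarrow> (\<forall>i. is_arg_max f (\<lambda>a. a \<in> A) (x $ i))"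
    (is "?L \<longleftrightarrow> ?R")
proof
  assume L: ?L
  then have x: "\<forall>i. x $ i \<in> A" and max: "\<And>y. \<forall>i. y $ i \<in> A \<Longrightarrow> U y \<le> U x"
    by (auto simp: is_arg_max_linorder)
  have "f a \<le> f (x $ i)" if "a \<in> A" for a i
  proof -
    define y where "y = (\<chi> k. if k = i then a else x $ k)"
    have y: "\<forall>k. y $ k \<in> A" using x that by (simp add: y_def)
    have "(\<Sum>k\<in>UNIV. f (y $ k)) \<le> (\<Sum>k\<in>UNIV. f (x $ k))"
      using max[OF y] U[OF y] U[OF x] c by simp
    moreover have "(\<Sum>k\<in>UNIV. f (y $ k)) = f a + (\<Sum>k\<in>UNIV - {i}. f (x $ k))"
      by (subst sum.remove[of _ i]) (auto simp: y_def)
    moreover have "(\<Sum>k\<in>UNIV. f (x $ k)) = f (x $ i) + (\<Sum>k\<in>UNIV - {i}. f (x $ k))"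
      by (rule sum.remove) auto
    ultimately show ?thesis by simp
  qed
  then show ?R using x by (simp add: is_arg_max_linorder)
next
  assume R: ?R
  then show ?L
    using c by (auto simp: is_arg_max_linorder U intro!: sum_mono)
qed

theorem lemma3p3:
  fixes \<D> :: "(real ^ 'k) set"
    and \<Theta> :: "(real ^ 'p) set"
    and prior :: "(real ^ 'p) measure"
    and \<mu> :: "real ^ 'p \<Rightarrow> real ^ 'k \<Rightarrow> real"
    and s1 s2 :: real
    and Dopt :: "real ^ 'k ^ 'n"
  assumes "CARD('p) \<le> CARD('n)"
    and "s1 > 0" and "s2 > 0"
    and "prob_space prior" and "sets prior = sets (restrict_space borel \<Theta>)"
    and "\<And>\<theta> d. \<theta> \<in> \<Theta> \<Longrightarrow> d \<in> \<D> \<Longrightarrow> (\<lambda>t. \<mu> t d) differentiable (at \<theta>)"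
    and "\<And>\<theta> (D :: real ^ 'k ^ 'n) i j. \<theta> \<in> \<Theta> \<Longrightarrow> D \<in> designs \<D> \<Longrightarrow>
           integrable (response_distr \<mu> s1 s2 \<theta> D)
             (\<lambda>y. score \<mu> s1 s2 \<theta> D y $ i * score \<mu> s1 s2 \<theta> D y $ j)"
    and "\<And>D :: real ^ 'k ^ 'n. D \<in> designs \<D> \<Longrightarrow>
           integrable prior (\<lambda>\<theta>. trace (fisher_information \<mu> s1 s2 \<theta> D))"
  shows "FIG_optimal \<D> prior \<mu> s1 s2 Dopt \<longleftrightarrow>
         (\<forall>i. is_arg_max (phi prior \<mu>) (\<lambda>d. d \<in> \<D>) (Dopt $ i))"
proof -
  let ?p = "\<lambda>d \<theta> j. partial_deriv (\<lambda>t. \<mu> t d) \<theta> j"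
  have space: "space prior = \<Theta>"
    using sets_eq_imp_space_eq[OF assms(5)] by (simp add: space_restrict_space)
  obtain c where c: "c > 0"
    "\<forall>(\<mu> :: real ^ 'p \<Rightarrow> real ^ 'k \<Rightarrow> real) \<theta> (D :: real ^ 'k ^ 'n).
       (\<forall>i. (\<lambda>t. \<mu> t (D $ i)) differentiable (at \<theta>)) \<longrightarrow>
       trace (fisher_information \<mu> s1 s2 \<theta> D) =
       c * (\<Sum>i\<in>UNIV. \<Sum>j\<in>UNIV. (partial_deriv (\<lambda>t. \<mu> t (D $ i)) \<theta> j)\<^sup>2)"
    using trace_fisher_information[OF assms(2,3), where 'p = 'p and 'k = 'k and 'n = 'n] by blast
  have trace: "trace (fisher_information \<mu> s1 s2 \<theta> D) = c * (\<Sum>i\<in>UNIV. \<Sum>j\<in>UNIV. (?p (D $ i) \<theta> j)\<^sup>2)"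
    if "D \<in> designs \<D>" "\<theta> \<in> \<Theta>" for D :: "real ^ 'k ^ 'n" and \<theta>
    using that assms(6) by (intro c(2)[rule_format]) (auto simp: designs_def)
  have int: "integrable prior (\<lambda>\<theta>. (?p d \<theta> j)\<^sup>2)" if d: "d \<in> \<D>" for d j
  proof -
    \<comment> \<open>The constant design at \<open>d\<close> isolates the terms belonging to \<open>d\<close> in the
    information trace, whose integrability is given.\<close>
    define D where "D = (\<chi> i :: 'n. d)"
    have D: "D \<in> designs \<D>" using d by (simp add: D_def designs_def)
    have "(\<lambda>\<theta>. ?p d \<theta> j) \<in> borel_measurable prior"
      using partial_deriv_measurable[of \<Theta> "\<lambda>t. \<mu> t d" j] assms(6) d
      by (simp add: measurable_cong_sets[OF assms(5) refl])
    then have meas: "(\<lambda>\<theta>. (?p d \<theta> j)\<^sup>2) \<in> borel_measurable prior"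
      by simp
    have le: "(?p d \<theta> j)\<^sup>2 \<le> trace (fisher_information \<mu> s1 s2 \<theta> D) / c" if "\<theta> \<in> \<Theta>" for \<theta>
    proof -
      have "(?p d \<theta> j)\<^sup>2 \<le> (\<Sum>j\<in>UNIV. (?p d \<theta> j)\<^sup>2)"
        by (rule member_le_sum) auto
      also have "\<dots> \<le> real CARD('n) * (\<Sum>j\<in>UNIV. (?p d \<theta> j)\<^sup>2)"
        using mult_right_mono[of 1 "real CARD('n)" "\<Sum>j\<in>UNIV. (?p d \<theta> j)\<^sup>2"]
        by (simp add: sum_nonneg Suc_le_eq)
      also have "\<dots> = trace (fisher_information \<mu> s1 s2 \<theta> D) / c"
        unfolding trace[OF D that] using c(1) by (simp add: D_def)
      finally show ?thesis .
    qed
    have "norm ((?p d \<theta> j)\<^sup>2) \<le> norm (trace (fisher_information \<mu> s1 s2 \<theta> D) / c)" if "\<theta> \<in> \<Theta>" for \<theta>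
      using le[OF that] zero_le_power2[of "?p d \<theta> j"] unfolding real_norm_def by linarith
    then have bound: "AE \<theta> in prior. norm ((?p d \<theta> j)\<^sup>2) \<le> norm (trace (fisher_information \<mu> s1 s2 \<theta> D) / c)"
      by (intro AE_I2) (simp only: space)
    have "integrable prior (\<lambda>\<theta>. trace (fisher_information \<mu> s1 s2 \<theta> D) / c)"
      using assms(8)[OF D] by simp
    then show ?thesis
      using meas bound by (rule Bochner_Integration.integrable_bound)
  qed
  have U: "U_FIG prior \<mu> s1 s2 D = c * (\<Sum>i\<in>UNIV. phi prior \<mu> (D $ i))"
    if D: "\<forall>i. D $ i \<in> \<D>" for D :: "real ^ 'k ^ 'n"
  proof -
    have "U_FIG prior \<mu> s1 s2 D = (\<integral>\<theta>. c * (\<Sum>i\<in>UNIV. \<Sum>j\<in>UNIV. (?p (D $ i) \<theta> j)\<^sup>2) \<partial>prior)"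
      unfolding U_FIG_def using D
      by (intro Bochner_Integration.integral_cong refl trace) (auto simp: space designs_def)
    also have "\<dots> = c * (\<Sum>i\<in>UNIV. phi prior \<mu> (D $ i))"
      using D int by (simp add: phi_def Bochner_Integration.integral_sum)
    finally show ?thesis .
  qed
  show ?thesis
    unfolding FIG_optimal_def designs_def mem_Collect_eq
    by (rule is_arg_max_separable_sum[OF c(1) U])
qed

end
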